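(* There is a sequence $G_1,G_2,\ldots$ of connected cubic graphs such that $\alpha'_g(G_k)<\frac{7}{18}|V(G_k)|$ for every $k\ge 1$.
   Context: Graphs are finite and simple. A cubic graph is a $3$-regular graph. The matching game on a graph $G$: two players, Max and Min, alternately add edges of $G$ to a set of chosen edges that must always remain a matching; the game ends when the chosen edges form a maximal matching of $G$ (no further edge can be added). Max wants the final matching to be large, Min wants it to be small. $\alpha'_g(G)$ denotes the size of the final matching under optimal play when Max moves first. *)

theory Defs
  imports Complex_Main
begin

text \<open>A graph is a pair of a vertex set and a set of edges, an edge being a two-element set of
  vertices.  Such graphs have neither loops nor multiple edges.\<close>

type_synonym 'a graph = "'a set \<times> 'a set set"

abbreviation verts :: "'a graph \<Rightarrow> 'a set" where "verts G \<equiv> fst G"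
abbreviation edges :: "'a graph \<Rightarrow> 'a set set" where "edges G \<equiv> snd G"

definition finite_simple_graph :: "'a graph \<Rightarrow> bool" where
  "finite_simple_graph G \<longleftrightarrow>
     finite (verts G) \<and> (\<forall>e\<in>edges G. e \<subseteq> verts G \<and> card e = 2)"

definition degree :: "'a graph \<Rightarrow> 'a \<Rightarrow> nat" where
  "degree G v = card {e \<in> edges G. v \<in> e}"

definition regular :: "nat \<Rightarrow> 'a graph \<Rightarrow> bool" where
  "regular r G \<longleftrightarrow> (\<forall>v\<in>verts G. degree G v = r)"

abbreviation cubic :: "'a graph \<Rightarrow> bool" where "cubic \<equiv> regular 3"

text \<open>The graph without vertices does not count as connected.\<close>

definition connected_graph :: "'a graph \<Rightarrow> bool" where
  "connected_graph G \<longleftrightarrow> verts G \<noteq> {} \<and>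
     (\<forall>u\<in>verts G. \<forall>v\<in>verts G. (u, v) \<in> {(x, y). {x, y} \<in> edges G}\<^sup>*)"

definition isomorphic :: "'a graph \<Rightarrow> 'b graph \<Rightarrow> bool" where
  "isomorphic G H \<longleftrightarrow> (\<exists>f. bij_betw f (verts G) (verts H) \<and>
     (\<forall>u\<in>verts G. \<forall>v\<in>verts G. {u, v} \<in> edges G \<longleftrightarrow> {f u, f v} \<in> edges H))"

definition matching :: "'a graph \<Rightarrow> 'a set set \<Rightarrow> bool" where
  "matching G M \<longleftrightarrow>
     M \<subseteq> edges G \<and> (\<forall>e\<in>M. \<forall>f\<in>M. e \<noteq> f \<longrightarrow> e \<inter> f = {})"

definition moves :: "'a graph \<Rightarrow> 'a set set \<Rightarrow> 'a set set" where
  "moves G M = {e \<in> edges G - M. matching G (insert e M)}"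

datatype player = MaxPlayer | MinPlayer

text \<open>The size of the final matching when both players play optimally from the position in which
  \<open>M\<close> is the set of chosen edges and the given player is to move (backward induction).  For a
  matching \<open>M\<close>, there is no move exactly if \<open>M\<close> is a maximal matching.  The value for an infinite
  edge set is a dummy that makes the function total.\<close>

function game_value :: "'a graph \<Rightarrow> player \<Rightarrow> 'a set set \<Rightarrow> nat" where
  "game_value G p M =
     (if infinite (edges G) \<or> moves G M = {} then card M
      else case p of
          MaxPlayer \<Rightarrow> Max ((\<lambda>e. game_value G MinPlayer (insert e M)) ` moves G M)
        | MinPlayer \<Rightarrow> Min ((\<lambda>e. game_value G MaxPlayer (insert e M)) ` moves G M))"
  by pat_completeness auto

lemma card_unchosen_decreases:
  assumes "finite (edges G)" "e \<in> moves G M"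
  shows "card (edges G - insert e M) < card (edges G - M)"
  using assms by (intro psubset_card_mono) (auto simp: moves_def)

termination
  by (relation "measure (\<lambda>(G, p, M). card (edges G - M))")
     (simp_all add: card_unchosen_decreases del: card_Diff_insert split_paired_All)

declare game_value.simps [simp del]

definition game_matching_number :: "'a graph \<Rightarrow> nat" where
  "game_matching_number G = game_value G MaxPlayer {}"

end

theory Submission
  imports Defs "HOL-Library.Nat_Bijection"
begin

text \<open>Take a tree with bipartition classes \<open>X\<close> and \<open>Y\<close> such that all vertices in \<open>Y\<close> have degree
  three, and attach caps (\<open>K\<^sub>4\<close> with one edge subdivided) at the vertices in \<open>X\<close> to make the graph
  cubic.  With \<open>k = |Y|\<close> there are \<open>2k + 1\<close> vertices in \<open>X\<close>, \<open>3k + 3\<close> caps and \<open>18k + 16\<close> vertices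
  in total.  Three chosen edges can meet a cap only if two of them match its four non-attaching
  vertices and the third is the bridge, and Min prevents this by responding in the cap that Max
  enters.  Every other edge meets \<open>Y\<close>, so at most
  \<open>2(3k + 3) + k = 7k + 6 < 7/18 (18k + 16)\<close> edges are chosen.\<close>

section \<open>Bounding the game value by a strategy of Min\<close>

text \<open>\<open>good\<close> is an invariant of positions with Max to move: after each move of
  Max, Min can restore it unless the game has ended within the bound. Every round decreases the
  number of unchosen edges, so induction applies, and the minimum over Min's moves is at most the
  value after the good reply.\<close>

lemma game_value_le_of_strategy:
  assumes fin: "finite (edges G)"
    and stop: "\<And>M. good M \<Longrightarrow> moves G M = {} \<Longrightarrow> card M \<le> N"
    and reply: "\<And>M e. good M \<Longrightarrow> e \<in> moves G M \<Longrightarrow>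
      (moves G (insert e M) = {} \<and> card (insert e M) \<le> N) \<or>
      (\<exists>f\<in>moves G (insert e M). good (insert f (insert e M)))"
    and "good M"
  shows "game_value G MaxPlayer M \<le> N"
  using \<open>good M\<close>
proof (induction "card (edges G - M)" arbitrary: M rule: less_induct)
  case less
  have finm: "finite (moves G M)" for M
    using fin by (simp add: moves_def)
  show ?case
  proof (cases "moves G M = {}")
    case True
    then show ?thesis using stop[OF less.prems] by (simp add: game_value.simps)
  next
    case False
    have "game_value G MinPlayer (insert e M) \<le> N" if e: "e \<in> moves G M" for e
      using reply[OF less.prems e]
    proof
      assume "moves G (insert e M) = {} \<and> card (insert e M) \<le> N"
      then show ?thesis by (simp add: game_value.simps)
    next
      assume "\<exists>f\<in>moves G (insert e M). good (insert f (insert e M))"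
      then obtain f where f: "f \<in> moves G (insert e M)" and good: "good (insert f (insert e M))"
        by blast
      have "card (edges G - insert f (insert e M)) < card (edges G - M)"
        using card_unchosen_decreases[OF fin e] card_unchosen_decreases[OF fin f] by linarith
      then have "game_value G MaxPlayer (insert f (insert e M)) \<le> N"
        using less.hyps good by blast
      moreover have "game_value G MinPlayer (insert e M) \<le>
          game_value G MaxPlayer (insert f (insert e M))"
        using f fin finm by (subst game_value.simps) (auto intro!: Min_le)
      ultimately show ?thesis by linarith
    qed
    then show ?thesis
      using False fin finm by (subst game_value.simps) auto
  qed
qed

lemma finite_edges: "finite_simple_graph G \<Longrightarrow> finite (edges G)"
  unfolding finite_simple_graph_def by (auto intro: finite_subset[of _ "Pow (verts G)"])

lemma matching_insert:
  assumes "matching G M" "f \<in> edges G" "\<And>e. e \<in> M \<Longrightarrow> f \<inter> e = {}"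
  shows "matching G (insert f M)"
  using assms unfolding matching_def by auto

text \<open>Distinct edges of a matching are disjoint, so two of them cannot both lie in
  \<open>T\<close>. It will be used with \<open>T\<close> the star of a vertex or the edge set of a
  triangle. If the intersection is infinite, its \<open>card\<close> is 0.\<close>

lemma card_matching_intersecting_le:
  assumes "matching G M" and "\<And>e f. e \<in> T \<Longrightarrow> f \<in> T \<Longrightarrow> e \<inter> f \<noteq> {}"
  shows "card (M \<inter> T) \<le> 1"
proof -
  have "e = f" if "e \<in> M \<inter> T" "f \<in> M \<inter> T" for e f
    using that assms(1) assms(2)[of e f] unfolding matching_def by blast
  then show ?thesis
    by (cases "finite (M \<inter> T)") (simp_all add: card_le_Suc0_iff_eq)
qed

text \<open>Min keeps every block either untouched or containing one of its key edges.  By \<open>reply\<close> a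
  single move of Max in an untouched block can be answered by a key edge, and if no answer is
  needed, then Min plays a key edge of an untouched block or, when there is none, any edge.\<close>

lemma game_matching_number_le_blocks:
  fixes G :: "'a graph" and block :: "'i \<Rightarrow> 'a set" and key :: "'i \<Rightarrow> 'a set set"
  assumes graph: "finite_simple_graph G" and finI: "finite I" and finY: "finite Y"
    and key_edges: "\<And>i. i \<in> I \<Longrightarrow> key i \<subseteq> edges G"
    and key_block: "\<And>i f. i \<in> I \<Longrightarrow> f \<in> key i \<Longrightarrow> f \<subseteq> block i"
    and key_ne: "\<And>i. i \<in> I \<Longrightarrow> key i \<noteq> {}"
    and reply: "\<And>i e. \<lbrakk>i \<in> I; e \<in> edges G; e \<inter> block i \<noteq> {}; e \<notin> key i\<rbrakk>
      \<Longrightarrow> \<exists>f\<in>key i. f \<inter> e = {}"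
    and bound: "\<And>i M. \<lbrakk>i \<in> I; matching G M; M \<inter> key i \<noteq> {}\<rbrakk>
      \<Longrightarrow> card {e \<in> M. e \<inter> block i \<noteq> {}} \<le> 2"
    and sep: "\<And>i j e. \<lbrakk>i \<in> I; j \<in> I; e \<in> edges G; e \<inter> block i \<noteq> {}; e \<inter> block j \<noteq> {}\<rbrakk>
      \<Longrightarrow> i = j"
    and cover: "\<And>e. e \<in> edges G \<Longrightarrow> (\<exists>i\<in>I. e \<inter> block i \<noteq> {}) \<or> e \<inter> Y \<noteq> {}"
  shows "game_matching_number G \<le> 2 * card I + card Y"
proof -
  define untouched where "untouched i M \<longleftrightarrow> (\<forall>e\<in>M. e \<inter> block i = {})" for i M
  define good where "good M \<longleftrightarrow> matching G M \<and> (\<forall>i\<in>I. untouched i M \<or> M \<inter> key i \<noteq> {})" for M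
  have finE: "finite (edges G)"
    using graph by (rule finite_edges)
  have edge_ne: "e \<noteq> {}" if "e \<in> edges G" for e
    using graph that unfolding finite_simple_graph_def by fastforce
  \<comment> \<open>Being nonempty and disjoint from every edge of \<open>M\<close>, the edge
    \<open>f\<close> cannot already belong to \<open>M\<close>.\<close>
  have movesI: "f \<in> moves G M \<and> matching G (insert f M)"
    if "matching G M" "f \<in> edges G" "\<And>e. e \<in> M \<Longrightarrow> f \<inter> e = {}" for f M
    using matching_insert[OF that] edge_ne[OF that(2)] that unfolding moves_def by auto
  have good_card: "card M \<le> 2 * card I + card Y" if "good M" for M
  proof -
    have M: "matching G M" and ME: "M \<subseteq> edges G"
      using that unfolding good_def matching_def by auto
    have fin: "finite M" using finE ME finite_subset by blast
    have blk: "card {e \<in> M. e \<inter> block i \<noteq> {}} \<le> 2" if "i \<in> I" for i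
    proof (cases "untouched i M")
      case True
      then have "{e \<in> M. e \<inter> block i \<noteq> {}} = {}" by (auto simp: untouched_def)
      then show ?thesis by (metis card.empty zero_le)
    next
      case False
      then show ?thesis using \<open>good M\<close> bound[OF \<open>i \<in> I\<close> M] \<open>i \<in> I\<close> by (auto simp: good_def)
    qed
    have one: "card (M \<inter> {e. y \<in> e}) \<le> 1" for y
      by (rule card_matching_intersecting_le[OF M]) auto
    \<comment> \<open>Each chosen edge is charged to a block that it meets or to a vertex of
      \<open>Y\<close> on it.\<close>
    have "M \<subseteq> (\<Union>i\<in>I. {e \<in> M. e \<inter> block i \<noteq> {}}) \<union> (\<Union>y\<in>Y. M \<inter> {e. y \<in> e})"
    proof
      fix e assume "e \<in> M"
      then show "e \<in> (\<Union>i\<in>I. {e \<in> M. e \<inter> block i \<noteq> {}}) \<union> (\<Union>y\<in>Y. M \<inter> {e. y \<in> e})"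
        using cover[of e] ME by auto
    qed
    then have "card M \<le> card ((\<Union>i\<in>I. {e \<in> M. e \<inter> block i \<noteq> {}}) \<union> (\<Union>y\<in>Y. M \<inter> {e. y \<in> e}))"
      by (rule card_mono[rotated]) (simp add: fin finI finY)
    also have "\<dots> \<le> (\<Sum>i\<in>I. card {e \<in> M. e \<inter> block i \<noteq> {}}) + (\<Sum>y\<in>Y. card (M \<inter> {e. y \<in> e}))"
      by (intro order_trans[OF card_Un_le] add_mono card_UN_le finI finY)
    also have "\<dots> \<le> (\<Sum>i\<in>I. 2) + (\<Sum>y\<in>Y. 1)"
      by (intro add_mono sum_mono blk one)
    finally show ?thesis by simp
  qed
  have "game_value G MaxPlayer {} \<le> 2 * card I + card Y"
  proof (rule game_value_le_of_strategy[where good = good, OF finE])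
    show "good {}" by (auto simp: good_def matching_def untouched_def)
    show "card M \<le> 2 * card I + card Y" if "good M" for M
      using good_card that .
    show "(moves G (insert e M) = {} \<and> card (insert e M) \<le> 2 * card I + card Y) \<or>
      (\<exists>f\<in>moves G (insert e M). good (insert f (insert e M)))"
      if M: "good M" and e: "e \<in> moves G M" for M e
    proof (cases "good (insert e M)")
      case True
      let ?M = "insert e M"
      have mM: "matching G ?M" using True by (simp add: good_def)
      consider (stop) "moves G ?M = {}" | (all) f where "f \<in> moves G ?M" "\<And>i. i \<in> I \<Longrightarrow> ?M \<inter> key i \<noteq> {}"
        | (untouched) i where "i \<in> I" "untouched i ?M"
        using True unfolding good_def by blast
      then show ?thesis
      proof cases
        case stop
        then show ?thesis using good_card[OF True] by blast
      next
        case all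
        then have "good (insert f ?M)" unfolding good_def moves_def by blast
        then show ?thesis using all by blast
      next
        case untouched
        obtain f where f: "f \<in> key i" using key_ne[OF \<open>i \<in> I\<close>] by blast
        have fE: "f \<in> edges G" and fb: "f \<subseteq> block i"
          using f key_edges key_block untouched by auto
        have mv: "f \<in> moves G ?M \<and> matching G (insert f ?M)"
          using movesI[OF mM fE] untouched(2) fb unfolding untouched_def by blast
        \<comment> \<open>The key edge \<open>f\<close> lies inside block \<open>i\<close>, so by
          \<open>sep\<close> it meets no other block.\<close>
        have "untouched j (insert f ?M) \<or> insert f ?M \<inter> key j \<noteq> {}" if "j \<in> I" for j
        proof (cases "j = i")
          case False
          then have "f \<inter> block j = {}"
            using sep[OF \<open>i \<in> I\<close> that fE] fb edge_ne[OF fE] by blast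
          then show ?thesis using True that unfolding good_def untouched_def by blast
        qed (use f in blast)
        then show ?thesis using mv unfolding good_def by blast
      qed
    next
      case False
      let ?M = "insert e M"
      have mM: "matching G ?M" and eE: "e \<in> edges G" using e by (auto simp: moves_def)
      \<comment> \<open>Max has just entered block \<open>i\<close> by an edge that is not a key
        edge. The key edge given by \<open>reply\<close> avoids \<open>e\<close>, and it avoids
        \<open>M\<close> because \<open>M\<close> has not met the block. By \<open>sep\<close>
        neither of the two new edges disturbs another block.\<close>
      obtain i where i: "i \<in> I" "\<not> untouched i ?M" "?M \<inter> key i = {}"
        using False mM unfolding good_def by blast
      then have "untouched i M" using M unfolding good_def by blast
      then have ei: "e \<inter> block i \<noteq> {}" using i unfolding untouched_def by auto
      obtain f where f: "f \<in> key i" "f \<inter> e = {}" using reply[OF i(1) eE ei] i by blast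
      have fE: "f \<in> edges G" and fb: "f \<subseteq> block i"
        using f key_edges key_block i by auto
      have "f \<inter> g = {}" if "g \<in> ?M" for g
        using that f(2) fb \<open>untouched i M\<close> unfolding untouched_def by blast
      then have mv: "f \<in> moves G ?M \<and> matching G (insert f ?M)"
        using movesI[OF mM fE] by blast
      have "untouched j (insert f ?M) \<or> insert f ?M \<inter> key j \<noteq> {}" if "j \<in> I" for j
      proof (cases "j = i")
        case False
        then have "f \<inter> block j = {}" "e \<inter> block j = {}"
          using sep[OF \<open>i \<in> I\<close> that fE] sep[OF \<open>i \<in> I\<close> that eE] fb edge_ne[OF fE] ei by blast+
        then show ?thesis using M that unfolding good_def untouched_def by blast
      qed (use f in blast)
      then show ?thesis using mv unfolding good_def by blast
    qed
  qed
  then show ?thesis by (simp add: game_matching_number_def)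
qed

section \<open>Attaching caps\<close>

text \<open>Together with \<open>cap\<close>, this codes the disjoint union of old vertices and cap
  vertices in the natural numbers, so that capping a \<open>nat graph\<close> gives a
  \<open>nat graph\<close> again.\<close>

definition stem :: "nat \<Rightarrow> nat" where
  "stem v = sum_encode (Inl v)"

definition cap :: "nat \<times> nat \<Rightarrow> nat \<Rightarrow> nat" where
  "cap i c = sum_encode (Inr (prod_encode (prod_encode i, c)))"

lemma stem_cap_simps [simp]:
  "stem u = stem v \<longleftrightarrow> u = v" "cap i c = cap j d \<longleftrightarrow> i = j \<and> c = d"
  "stem u \<noteq> cap i c" "cap i c \<noteq> stem u"
  by (auto simp: stem_def cap_def sum_encode_eq prod_encode_eq)

text \<open>Vertex \<open>0\<close> of a cap is the one that subdivides an edge of \<open>K\<^sub>4\<close>, and the bridge is attached there.\<close>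

definition cap_edges :: "nat set set" where
  "cap_edges = {{0,1},{0,2},{1,3},{1,4},{2,3},{2,4},{3,4}}"

text \<open>A slot stands for one edge that a vertex lacks to reach degree three, and it serves as
  the index of the cap attached there. The second component only tells apart the slots of one
  vertex.\<close>

definition slots :: "nat graph \<Rightarrow> (nat \<times> nat) set" where
  "slots H = (SIGMA v : verts H. {..<3 - degree H v})"

definition capped :: "nat graph \<Rightarrow> nat graph" where
  "capped H =
    (stem ` verts H \<union> (\<Union>i\<in>slots H. cap i ` {..<5}),
     image stem ` edges H \<union> (\<lambda>i. {stem (fst i), cap i 0}) ` slots H \<union>
       (\<Union>i\<in>slots H. image (cap i) ` cap_edges))"

lemma finite_slots: "finite_simple_graph H \<Longrightarrow> finite (slots H)"
  by (simp add: slots_def finite_simple_graph_def)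

lemma verts_cappedI:
  "v \<in> verts H \<Longrightarrow> stem v \<in> verts (capped H)"
  "i \<in> slots H \<Longrightarrow> c < 5 \<Longrightarrow> cap i c \<in> verts (capped H)"
  by (auto simp: capped_def)

lemma edges_cappedI:
  "e \<in> edges H \<Longrightarrow> stem ` e \<in> edges (capped H)"
  "i \<in> slots H \<Longrightarrow> {stem (fst i), cap i 0} \<in> edges (capped H)"
  "i \<in> slots H \<Longrightarrow> f \<in> cap_edges \<Longrightarrow> cap i ` f \<in> edges (capped H)"
  unfolding capped_def by force+

lemma edges_capped_cases [consumes 1, case_names stem link cap]:
  assumes "e \<in> edges (capped H)"
  obtains f where "f \<in> edges H" "e = stem ` f"
    | i where "i \<in> slots H" "e = {stem (fst i), cap i 0}"
    | i f where "i \<in> slots H" "f \<in> cap_edges" "e = cap i ` f"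
  using assms by (auto simp: capped_def)

lemma finite_simple_graph_capped:
  assumes H: "finite_simple_graph H"
  shows "finite_simple_graph (capped H)"
  unfolding finite_simple_graph_def
proof (intro conjI ballI)
  show "finite (verts (capped H))"
    using H finite_slots[OF H] by (simp add: capped_def finite_simple_graph_def)
next
  fix e assume "e \<in> edges (capped H)"
  then have "e \<subseteq> verts (capped H) \<and> card e = 2"
  proof (cases rule: edges_capped_cases)
    case (stem f)
    then have "f \<subseteq> verts H" "card f = 2" using H by (auto simp: finite_simple_graph_def)
    then show ?thesis using stem by (auto simp: card_image inj_on_def intro: verts_cappedI)
  next
    case (link i)
    then have "fst i \<in> verts H" by (auto simp: slots_def)
    then show ?thesis using link by (auto intro: verts_cappedI)
  next
    case (cap i f)
    then have "f \<subseteq> {..<5}" "card f = 2" by (auto simp: cap_edges_def)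
    then have "card e = 2" using cap by (simp add: card_image inj_on_def)
    moreover have "e \<subseteq> verts (capped H)"
      using cap \<open>f \<subseteq> {..<5}\<close> by (auto intro!: verts_cappedI)
    ultimately show ?thesis by blast
  qed
  then show "e \<subseteq> verts (capped H)" "card e = 2" by auto
qed

lemma card_verts_capped:
  assumes "finite_simple_graph H"
  shows "card (verts (capped H)) = card (verts H) + 5 * card (slots H)"
proof -
  have "card (\<Union>i\<in>slots H. cap i ` {..<5}) = (\<Sum>i\<in>slots H. card (cap i ` {..<5}))"
    using finite_slots[OF assms] by (intro card_UN_disjoint) auto
  also have "\<dots> = 5 * card (slots H)"
    by (simp add: card_image inj_on_def)
  finally have "card (\<Union>i\<in>slots H. cap i ` {..<5}) = 5 * card (slots H)" .
  moreover have "card (stem ` verts H) = card (verts H)" by (simp add: card_image inj_on_def)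
  ultimately show ?thesis
    using assms finite_slots[OF assms] unfolding capped_def finite_simple_graph_def
    by (simp, subst card_Un_disjoint) auto
qed

text \<open>At a stem, old edges and bridges add up to three, the degree bound making the truncated
  subtraction exact. In a cap, vertex 0 has degree two and gains the bridge; the other four have
  degree three already.\<close>

lemma cubic_capped:
  assumes H: "finite_simple_graph H" and deg: "\<And>v. v \<in> verts H \<Longrightarrow> degree H v \<le> 3"
  shows "cubic (capped H)"
proof -
  have stem: "degree (capped H) (stem v) = 3" if v: "v \<in> verts H" for v
  proof -
    let ?A = "image stem ` {e \<in> edges H. v \<in> e}"
    let ?B = "(\<lambda>k. {stem v, cap (v, k) 0}) ` {..<3 - degree H v}"
    have "{e \<in> edges (capped H). stem v \<in> e} = ?A \<union> ?B"
      using v by (auto simp: capped_def slots_def image_iff)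
    moreover have "card ?A = degree H v"
      unfolding degree_def by (intro card_image inj_onI) (auto simp: inj_image_eq_iff inj_def)
    moreover have "card ?B = 3 - degree H v"
      by (subst card_image) (auto simp: inj_on_def doubleton_eq_iff)
    moreover have "?A \<inter> ?B = {}" by (auto dest!: equalityD2)
    ultimately show ?thesis
      using deg[OF v] finite_edges[OF H] unfolding degree_def[of "capped H"]
      by (simp add: card_Un_disjoint)
  qed
  have cap: "degree (capped H) (cap i c) = 3" if i: "i \<in> slots H" and "c < 5" for i c
  proof -
    let ?A = "image (cap i) ` {f \<in> cap_edges. c \<in> f}"
    let ?B = "if c = 0 then {{stem (fst i), cap i 0}} else {}"
    have "{e \<in> edges (capped H). cap i c \<in> e} = ?A \<union> ?B"
      using i by (auto elim!: edges_capped_cases intro: edges_cappedI split: if_splits)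
    moreover have "card ?A = card {f \<in> cap_edges. c \<in> f}"
      by (intro card_image inj_onI) (auto simp: inj_image_eq_iff inj_def)
    moreover have "?A \<inter> ?B = {}" by (auto dest!: equalityD1)
    moreover have "finite ?A" by (simp add: cap_edges_def)
    ultimately have "degree (capped H) (cap i c) = card {f \<in> cap_edges. c \<in> f} + card ?B"
      unfolding degree_def[of "capped H"] by (simp add: card_Un_disjoint)
    moreover have "card {f \<in> cap_edges. c \<in> f} = (if c = 0 then 2 else 3)"
    proof -
      have "{f \<in> cap_edges. 0 \<in> f} = {{0,1},{0,2}}" "{f \<in> cap_edges. 1 \<in> f} = {{0,1},{1,3},{1,4}}"
        "{f \<in> cap_edges. 2 \<in> f} = {{0,2},{2,3},{2,4}}" "{f \<in> cap_edges. 3 \<in> f} = {{1,3},{2,3},{3,4}}"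
        "{f \<in> cap_edges. 4 \<in> f} = {{1,4},{2,4},{3,4}}"
        by (auto simp: cap_edges_def)
      moreover have "c \<in> {0, 1, 2, 3, 4}" using \<open>c < 5\<close> by auto
      ultimately show ?thesis by (elim insertE emptyE) (simp_all add: doubleton_eq_iff)
    qed
    ultimately show ?thesis by simp
  qed
  show ?thesis
    unfolding regular_def using stem cap by (auto simp: capped_def)
qed

lemma connected_graphI:
  assumes r: "r \<in> verts G"
    and reach: "\<And>v. v \<in> verts G \<Longrightarrow> (r, v) \<in> {(x, y). {x, y} \<in> edges G}\<^sup>*"
  shows "connected_graph G"
proof -
  have "sym ({(x, y). {x, y} \<in> edges G}\<^sup>*)"
    by (intro sym_rtrancl) (auto simp: sym_def insert_commute)
  then have "(u, v) \<in> {(x, y). {x, y} \<in> edges G}\<^sup>*" if "u \<in> verts G" "v \<in> verts G" for u v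
    using reach[OF that(1)] reach[OF that(2)] by (rule rtrancl_trans[OF symD])
  then show ?thesis
    using r unfolding connected_graph_def by blast
qed

lemma connected_graph_capped:
  assumes H: "connected_graph H"
  shows "connected_graph (capped H)"
proof -
  let ?R = "{(x, y). {x, y} \<in> edges (capped H)}"
  obtain r where r: "r \<in> verts H" using H unfolding connected_graph_def by blast
  have stem: "(stem r, stem v) \<in> ?R\<^sup>*" if "v \<in> verts H" for v
  proof -
    have "(r, v) \<in> {(x, y). {x, y} \<in> edges H}\<^sup>*"
      using H r that unfolding connected_graph_def by blast
    then show ?thesis
    proof induction
      case (step y z)
      then have "(stem y, stem z) \<in> ?R"
        using edges_cappedI(1)[of "{y, z}" H] by simp
      then show ?case using step.IH by (rule rtrancl_into_rtrancl[rotated])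
    qed simp
  qed
  have cap: "(stem r, cap i c) \<in> ?R\<^sup>*" if i: "i \<in> slots H" and "c < 5" for i c
  proof -
    have edge: "(cap i c, cap i d) \<in> ?R" if "{c, d} \<in> cap_edges" for c d
      using edges_cappedI(3)[OF i that] by simp
    have "fst i \<in> verts H" using i by (auto simp: slots_def)
    then have "(stem r, stem (fst i)) \<in> ?R\<^sup>*" by (rule stem)
    moreover have "(stem (fst i), cap i 0) \<in> ?R" using edges_cappedI(2)[OF i] by simp
    ultimately have 0: "(stem r, cap i 0) \<in> ?R\<^sup>*" by (rule rtrancl_into_rtrancl)
    \<comment> \<open>Inside the cap, 1 and 2 are neighbours of 0, while 3 and 4 are neighbours of
      1.\<close>
    have 1: "(stem r, cap i 1) \<in> ?R\<^sup>*" and 2: "(stem r, cap i 2) \<in> ?R\<^sup>*"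
      by (rule rtrancl_into_rtrancl[OF 0 edge], simp add: cap_edges_def)+
    have 3: "(stem r, cap i 3) \<in> ?R\<^sup>*" and 4: "(stem r, cap i 4) \<in> ?R\<^sup>*"
      by (rule rtrancl_into_rtrancl[OF 1 edge], simp add: cap_edges_def)+
    consider "c = 0" | "c = 1" | "c = 2" | "c = 3" | "c = 4" using \<open>c < 5\<close> by linarith
    then show ?thesis using 0 1 2 3 4 by cases simp_all
  qed
  show ?thesis
    by (rule connected_graphI[of "stem r"]) (use r stem cap in \<open>auto simp: capped_def\<close>)
qed

section \<open>The game on capped graphs\<close>

text \<open>The blocks are the caps. Three disjoint edges meet a cap only if they are the bridge
  together with 13 and 24, or with 14 and 23. The key edges 01, 02 and 34 are those edges meeting
  the cap that lie in neither triple, so one of them limits the cap to two chosen edges.\<close>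

lemma game_matching_number_capped_le:
  assumes H: "finite_simple_graph H" and "finite Y"
    and cover: "\<And>e. e \<in> edges H \<Longrightarrow> e \<inter> Y \<noteq> {}"
  shows "game_matching_number (capped H) \<le> 2 * card (slots H) + card Y"
proof -
  define key where "key i = {{cap i 0, cap i 1}, {cap i 0, cap i 2}, {cap i 3, cap i 4}}" for i
  define block where "block i = {cap i 0, cap i 1, cap i 2, cap i 3, cap i 4}" for i
  \<comment> \<open>The bridge and the seven cap edges are all that can meet the block, so claims
    about a cap become checks of eight cases.\<close>
  define near where "near i = {{stem (fst i), cap i 0}, {cap i 0, cap i 1}, {cap i 0, cap i 2},
      {cap i 1, cap i 3}, {cap i 1, cap i 4}, {cap i 2, cap i 3}, {cap i 2, cap i 4},
      {cap i 3, cap i 4}}" for i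
  have edge_near: "e \<in> near i"
    if "e \<in> edges (capped H)" "e \<inter> block i \<noteq> {}" for i e
    using that(1)
  proof (cases rule: edges_capped_cases)
    case (stem f)
    then have False using that(2) by (auto simp: block_def)
    then show ?thesis ..
  next
    case (link j)
    then have "j = i" using that(2) by (auto simp: block_def)
    then show ?thesis using link by (simp add: near_def)
  next
    case (cap j f)
    then have "j = i" using that(2) by (auto simp: block_def)
    then show ?thesis using cap(2,3) unfolding cap_edges_def near_def
      by (elim insertE emptyE) simp_all
  qed
  have "game_matching_number (capped H) \<le> 2 * card (slots H) + card (stem ` Y)"
  proof (rule game_matching_number_le_blocks[where block = block and key = key])
    show "finite_simple_graph (capped H)" using H by (rule finite_simple_graph_capped)
    show "finite (slots H)" using H by (rule finite_slots)
    show "finite (stem ` Y)" using \<open>finite Y\<close> by simp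
    show "key i \<subseteq> edges (capped H)" if "i \<in> slots H" for i
    proof -
      have "key i \<subseteq> image (cap i) ` cap_edges" by (simp add: key_def cap_edges_def)
      then show ?thesis using edges_cappedI(3)[OF that] by blast
    qed
    show "f \<subseteq> block i" if "f \<in> key i" for i f
      using that by (auto simp: key_def block_def)
    show "key i \<noteq> {}" for i by (simp add: key_def)
    \<comment> \<open>Min answers the bridge by 34, the edges 13 and 14 by 02, and the edges 23 and
      24 by 01.\<close>
    show "\<exists>f\<in>key i. f \<inter> e = {}" if "e \<in> edges (capped H)" "e \<inter> block i \<noteq> {}" "e \<notin> key i" for i e
      using edge_near[OF that(1,2)] that(3) unfolding near_def
      by (elim insertE emptyE) (simp_all add: key_def)
    show "i = j" if "e \<in> edges (capped H)" "e \<inter> block i \<noteq> {}" "e \<inter> block j \<noteq> {}" for i j e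
      using that by (cases rule: edges_capped_cases) (auto simp: block_def)
    show "(\<exists>i\<in>slots H. e \<inter> block i \<noteq> {}) \<or> e \<inter> stem ` Y \<noteq> {}" if "e \<in> edges (capped H)" for e
      using that
    proof (cases rule: edges_capped_cases)
      case (stem f)
      then show ?thesis using cover[of f] by auto
    next
      case (link i)
      then show ?thesis by (auto simp: block_def)
    next
      case (cap i f)
      then have "e \<inter> block i \<noteq> {}"
        unfolding cap_edges_def block_def by (elim insertE emptyE) simp_all
      then show ?thesis using cap by blast
    qed
    show "card {e \<in> M. e \<inter> block i \<noteq> {}} \<le> 2"
      if M: "matching (capped H) M" and key: "M \<inter> key i \<noteq> {}" for i M
    proof -
      have ME: "M \<subseteq> edges (capped H)" using M by (simp add: matching_def)
      have fin: "finite M"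
        using finite_subset[OF ME finite_edges[OF finite_simple_graph_capped[OF H]]] .
      obtain f where f: "f \<in> M" "f \<in> key i" using key by blast
      have disj: "e = f \<or> e \<inter> f = {}" if "e \<in> M" for e
        using M f that unfolding matching_def by blast
      \<comment> \<open>Chosen edges at the cap other than \<open>f\<close> avoid \<open>f\<close>.
        If all candidates for them intersect pairwise, at most one is chosen.\<close>
      have two: ?thesis
        if near: "\<And>e. e \<in> near i \<Longrightarrow> e \<inter> f = {} \<Longrightarrow> e \<in> T"
          and inter: "\<And>d e. d \<in> T \<Longrightarrow> e \<in> T \<Longrightarrow> d \<inter> e \<noteq> {}" for T
      proof -
        have "{e \<in> M. e \<inter> block i \<noteq> {}} \<subseteq> insert f (M \<inter> T)"
          using near edge_near ME disj by blast
        then have "card {e \<in> M. e \<inter> block i \<noteq> {}} \<le> card (insert f (M \<inter> T))"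
          using fin by (intro card_mono) simp_all
        also have "\<dots> \<le> Suc (card (M \<inter> T))" by (rule card_insert_le_m1) auto
        also have "\<dots> \<le> 2" using card_matching_intersecting_le[OF M inter] by simp
        finally show ?thesis .
      qed
      \<comment> \<open>The edges left over form the triangle 2, 3, 4 beside 01 and the triangle 1,
        3, 4 beside 02. Beside 34 they all contain vertex 0, since the edge 12 of the complete graph
        was subdivided.\<close>
      consider (01) "f = {cap i 0, cap i 1}" | (02) "f = {cap i 0, cap i 2}"
        | (34) "f = {cap i 3, cap i 4}"
        using f(2) by (auto simp: key_def)
      then show ?thesis
      proof cases
        case 01
        have "e \<in> {{cap i 2, cap i 3}, {cap i 2, cap i 4}, {cap i 3, cap i 4}}"
          if "e \<in> near i" "e \<inter> f = {}" for e
          using that unfolding near_def by (elim insertE emptyE) (simp_all add: 01)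
        then show ?thesis by (rule two) auto
      next
        case 02
        have "e \<in> {{cap i 1, cap i 3}, {cap i 1, cap i 4}, {cap i 3, cap i 4}}"
          if "e \<in> near i" "e \<inter> f = {}" for e
          using that unfolding near_def by (elim insertE emptyE) (simp_all add: 02)
        then show ?thesis by (rule two) auto
      next
        case 34
        have "e \<in> {e. cap i 0 \<in> e}"
          if "e \<in> near i" "e \<inter> f = {}" for e
          using that unfolding near_def by (elim insertE emptyE) (simp_all add: 34)
        then show ?thesis by (rule two) auto
      qed
    qed
  qed
  then show ?thesis by (simp add: card_image inj_on_def)
qed

section \<open>Numbers of slots, and the trees to be capped\<close>

lemma handshake:
  assumes "finite_simple_graph G"
  shows "(\<Sum>v\<in>verts G. degree G v) = 2 * card (edges G)"
  unfolding degree_def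
proof (rule sum_multicount)
  show "finite (verts G)" "finite (edges G)"
    using assms finite_edges[OF assms] by (simp_all add: finite_simple_graph_def)
  show "\<forall>e\<in>edges G. card {v \<in> verts G. v \<in> e} = 2"
  proof
    fix e assume "e \<in> edges G"
    then have "{v \<in> verts G. v \<in> e} = e" "card e = 2"
      using assms by (auto simp: finite_simple_graph_def)
    then show "card {v \<in> verts G. v \<in> e} = 2" by simp
  qed
qed

text \<open>Degrees and missing degrees add up to three at every vertex, and the degrees sum to
  twice the number of edges.\<close>

lemma card_slots:
  assumes H: "finite_simple_graph H" and deg: "\<And>v. v \<in> verts H \<Longrightarrow> degree H v \<le> 3"
  shows "card (slots H) + 2 * card (edges H) = 3 * card (verts H)"
proof -
  have fin: "finite (verts H)" using H by (simp add: finite_simple_graph_def)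
  have "card (slots H) + 2 * card (edges H) = (\<Sum>v\<in>verts H. (3 - degree H v) + degree H v)"
    using fin by (simp add: slots_def sum.distrib handshake[OF H])
  also have "\<dots> = (\<Sum>v\<in>verts H. 3)" using deg by (intro sum.cong) auto
  finally show ?thesis by simp
qed

text \<open>The path \<open>0, 1, 3, 4, 6, 7, \<dots>, 3k\<close> with a leaf \<open>3i + 2\<close> attached to each \<open>3i + 1\<close>: the vertices
  \<open>3i + 1\<close> form a vertex cover and have degree three.\<close>

definition parent :: "nat \<Rightarrow> nat" where
  "parent v = (if 3 dvd v then v - 2 else v - 1)"

definition skeleton :: "nat \<Rightarrow> nat graph" where
  "skeleton k = ({..3 * k}, (\<lambda>v. {parent v, v}) ` {1..3 * k})"

text \<open>This makes the skeleton a tree with root 0: there are no loops, an edge determines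
  \<open>v\<close> as its larger end, and iterated parents descend to 0.\<close>

lemma parent_less: "v \<ge> 1 \<Longrightarrow> parent v < v"
  by (auto simp: parent_def)

lemma finite_simple_graph_skeleton: "finite_simple_graph (skeleton k)"
  using parent_less by (fastforce simp: finite_simple_graph_def skeleton_def)

lemma card_edges_skeleton: "card (edges (skeleton k)) = 3 * k"
proof -
  have "inj_on (\<lambda>v. {parent v, v}) {1..3 * k}"
  proof (rule inj_onI)
    fix u v assume "u \<in> {1..3 * k}" "v \<in> {1..3 * k}" "{parent u, u} = {parent v, v}"
    then show "u = v" using parent_less[of u] parent_less[of v] by (auto simp: doubleton_eq_iff)
  qed
  then show ?thesis by (simp add: skeleton_def card_image)
qed

lemma degree_skeleton_le: "degree (skeleton k) v \<le> 3"
proof -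
  \<comment> \<open>A parent is one or two less than its child, so the only possible children of
    \<open>v\<close> are \<open>v + 1\<close> and \<open>v + 2\<close>.\<close>
  have "\<exists>a b. \<forall>u\<ge>1. parent u = v \<longrightarrow> u \<in> {a, b}"
    by (intro exI[of _ "v + 1"] exI[of _ "v + 2"]) (auto simp: parent_def split: if_splits)
  then obtain a b where ab: "\<And>u. u \<ge> 1 \<Longrightarrow> parent u = v \<Longrightarrow> u = a \<or> u = b" by blast
  have "{e \<in> edges (skeleton k). v \<in> e} \<subseteq> {{parent v, v}, {v, a}, {v, b}}"
    using ab by (fastforce simp: skeleton_def)
  then have "degree (skeleton k) v \<le> card {{parent v, v}, {v, a}, {v, b}}"
    unfolding degree_def by (intro card_mono) auto
  also have "\<dots> \<le> 3" using card_length[of "[{parent v, v}, {v, a}, {v, b}]"] by simp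
  finally show ?thesis .
qed

lemma connected_graph_skeleton: "connected_graph (skeleton k)"
proof (rule connected_graphI[of 0])
  show "(0, v) \<in> {(x, y). {x, y} \<in> edges (skeleton k)}\<^sup>*" if "v \<in> verts (skeleton k)" for v
    using that
  proof (induction v rule: less_induct)
    case (less v)
    show ?case
    proof (cases "v = 0")
      case False
      then have "(0, parent v) \<in> {(x, y). {x, y} \<in> edges (skeleton k)}\<^sup>*"
        using less parent_less[of v] by (auto simp: skeleton_def)
      moreover have "{parent v, v} \<in> edges (skeleton k)"
        using False less.prems by (auto simp: skeleton_def)
      ultimately show ?thesis by (auto intro: rtrancl_into_rtrancl)
    qed simp
  qed
qed (simp add: skeleton_def)

lemma skeleton_cover:
  assumes "e \<in> edges (skeleton k)"
  shows "e \<inter> (\<lambda>i. 3 * i + 1) ` {..<k} \<noteq> {}"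
proof -
  obtain v where v: "1 \<le> v" "v \<le> 3 * k" "e = {parent v, v}"
    using assms by (auto simp: skeleton_def)
  \<comment> \<open>The edges come in groups of three sharing the vertex \<open>3 * i + 1\<close>:
    it is the larger end for \<open>v = 3 * i + 1\<close> and the parent for the next two values of
    \<open>v\<close>.\<close>
  define i where "i = (v - 1) div 3"
  have "v = 3 * i + 1 \<or> v = 3 * i + 2 \<or> v = 3 * i + 3" using v(1) unfolding i_def by presburger
  moreover have "\<not> 3 dvd 3 * i + 2" "3 dvd 3 * i + 3" by presburger+
  ultimately have "3 * i + 1 \<in> e" using v(3) by (auto simp: parent_def)
  moreover have "i < k" using v(1,2) unfolding i_def by linarith
  ultimately show ?thesis by blast
qed

section \<open>The sequence of graphs\<close>

theorem theorem5p5: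
  shows "\<exists>G :: nat \<Rightarrow> nat graph.
    (\<forall>k\<ge>1. finite_simple_graph (G k) \<and> connected_graph (G k) \<and> cubic (G k) \<and>
       real (game_matching_number (G k)) < 7 / 18 * real (card (verts (G k)))) \<and>
    (\<forall>j\<ge>1. \<forall>k\<ge>1. j \<noteq> k \<longrightarrow> \<not> isomorphic (G j) (G k))"
proof (intro exI[of _ "\<lambda>k. capped (skeleton k)"] conjI allI impI)
  fix k :: nat
  note H = finite_simple_graph_skeleton[of k]
  show "finite_simple_graph (capped (skeleton k))" using H by (rule finite_simple_graph_capped)
  show "connected_graph (capped (skeleton k))"
    using connected_graph_skeleton by (rule connected_graph_capped)
  show "cubic (capped (skeleton k))" using H degree_skeleton_le by (rule cubic_capped)
next
  \<comment> \<open>This is \<open>3 * (3 * k + 1) - 2 * (3 * k)\<close>. The edge count has to be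
    rewritten before \<open>skeleton\<close> is unfolded.\<close>
  have slots: "card (slots (skeleton k)) = 3 * k + 3" for k
    using card_slots[OF finite_simple_graph_skeleton degree_skeleton_le, of k]
    by (simp add: card_edges_skeleton) (simp add: skeleton_def)
  have verts: "card (verts (capped (skeleton k))) = 18 * k + 16" for k
    using card_verts_capped[OF finite_simple_graph_skeleton, of k]
    by (simp add: slots) (simp add: skeleton_def)
  show "real (game_matching_number (capped (skeleton k))) <
      7 / 18 * real (card (verts (capped (skeleton k))))" for k
  proof -
    have "card ((\<lambda>i. 3 * i + 1) ` {..<k}) = k" by (simp add: card_image inj_on_def)
    then have "game_matching_number (capped (skeleton k)) \<le> 7 * k + 6"
      using game_matching_number_capped_le[OF finite_simple_graph_skeleton[of k] _ skeleton_cover[of _ k]]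
      by (simp add: slots)
    \<comment> \<open>The right-hand side equals \<open>7 * k + 56 / 9\<close>, which exceeds
      \<open>7 * k + 6\<close> by \<open>2 / 9\<close>.\<close>
    then show ?thesis by (simp add: verts)
  qed
  show "\<not> isomorphic (capped (skeleton j)) (capped (skeleton k))" if "j \<noteq> k" for j k
  proof
    assume "isomorphic (capped (skeleton j)) (capped (skeleton k))"
    then have "card (verts (capped (skeleton j))) = card (verts (capped (skeleton k)))"
      unfolding isomorphic_def by (auto dest: bij_betw_same_card)
    then show False using that by (simp add: verts)
  qed
qed

end
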